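(* Let $f:[0,\infty)\to\mathbb{R}$ be a function that is differentiable on $(0,\infty)$, let $0<u<v$, and suppose $f'\in L[u,v]$. Let $q\ge 1$. If $|f'|^q$ is convex on $[u,v]$, then for each $x\in[u,v]$, $$\left|\frac{(v-x)(vf(v)-uf(x))+(x-u)(vf(x)-uf(u))}{(v-u)^2}-\frac{1}{v-u}\int_u^v f(\mu)\,d\mu\right|$$ $$\le \frac{(v-x)^2}{(v-u)^2}A^{1-\frac1q}(u,v)\left(\frac16\right)^{\frac1q}\Big((2u+v)|f'(x)|^q+(2v+u)|f'(v)|^q\Big)^{\frac1q}$$ $$+\frac{(x-u)^2}{(v-u)^2}A^{1-\frac1q}(u,v)\left(\frac16\right)^{\frac1q}\Big((2v+u)|f'(x)|^q+(2u+v)|f'(u)|^q\Big)^{\frac1q}.$$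
   Context: $L[u,v]$ denotes the space of Lebesgue integrable functions on $[u,v]$. $A(u,v)=\frac{u+v}{2}$ is the arithmetic mean, and $A^{r}(u,v)=(A(u,v))^{r}$. *)

theory Defs
  imports "HOL-Analysis.Analysis"
begin

definition arith_mean :: "real \<Rightarrow> real \<Rightarrow> real" where
  "arith_mean u v = (u + v) / 2"

end

theory Submission
  imports Defs
begin

text \<open>
  Each half of the left-hand side comes from an integration by parts against an affine weight.
  On \<open>[a, b]\<close> let \<open>w\<close> be the affine function with \<open>w a = (b - a) p\<close> and \<open>w b = (b - a) r\<close>; then
  the integral of \<open>w f'\<close> is \<open>(b - a) (r f b - p f a)\<close> minus \<open>r - p\<close> times the integral of \<open>f\<close>.
  With \<open>p = u\<close> and \<open>r = v\<close> on both \<open>[u, x]\<close> and \<open>[x, v]\<close>, the two identities add up to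
  \<open>(v - u)\<^sup>2\<close> times the quantity to be estimated.

  On each piece, convexity bounds \<open>\<bar>f'\<bar> powr q\<close> by its chord, and the power mean inequality
  (\<open>abs_integral_le_power_mean\<close>) bounds the integral of \<open>w f'\<close> by the integral of \<open>w\<close> and that
  of \<open>w\<close> times the chord.  Both integrands are polynomials, and their integrals
  \<open>(b - a)\<^sup>2 (p + r) / 2\<close> and \<open>(b - a)\<^sup>2 ((2 p + r) P + (2 r + p) Q) / 6\<close>, where \<open>P\<close> and \<open>Q\<close> are
  the values of \<open>\<bar>f'\<bar> powr q\<close> at \<open>a\<close> and \<open>b\<close>, give the constants of the theorem
  (\<open>abs_affine_weighted_increment_le\<close>).
\<close>

text \<open>
  Young's inequality with the weights \<open>1 - 1/q\<close> and \<open>1/q\<close>.  Divided by \<open>m powr (1 - 1/q)\<close>, it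
  says that the graph of the concave function \<open>z powr (1/q)\<close> lies below its tangent at \<open>m\<close>.
\<close>

lemma powr_inverse_le_tangent:
  fixes z m q :: real
  assumes "0 \<le> z" "0 < m" "1 \<le> q"
  shows "m powr (1 - 1 / q) * z powr (1 / q) \<le> z / q + (1 - 1 / q) * m"
proof (cases "z = 0")
  case True
  with assms show ?thesis by simp
next
  case False
  have "m powr (1 - 1 / q) * z powr (1 / q) \<le> (1 - 1 / q) * m + (1 / q) * z"
    using assms False by (intro Youngs_inequality_0) auto
  then show ?thesis by simp
qed

text \<open>
  The power mean inequality, with \<open>C powr (1/q)\<close> replaced by its tangent at a constant \<open>m\<close>: the
  estimate is then linear in \<open>C\<close>, so that gauge integrals suffice.  The best \<open>m\<close> is the weighted
  mean \<open>M / A\<close>.  As this may be zero, where for \<open>q > 1\<close> there is no tangent of finite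
  slope, the constant \<open>(M + e) / A\<close> is used and \<open>e\<close> tends to zero.
\<close>

lemma abs_integral_le_power_mean:
  fixes g w C :: "real \<Rightarrow> real" and q A M I :: real
  assumes g: "(g has_integral I) S"
    and w: "(w has_integral A) S"
    and wC: "((\<lambda>y. w y * C y) has_integral M) S"
    and w_nonneg: "\<And>y. y \<in> S \<Longrightarrow> 0 \<le> w y"
    and C_nonneg: "\<And>y. y \<in> S \<Longrightarrow> 0 \<le> C y"
    and g_le: "\<And>y. y \<in> S \<Longrightarrow> \<bar>g y\<bar> \<le> w y * C y powr (1 / q)"
    and "0 < A" and "1 \<le> q"
  shows "\<bar>I\<bar> \<le> A powr (1 - 1 / q) * M powr (1 / q)"
proof -
  have M: "0 \<le> M"
    using has_integral_nonneg[OF wC] w_nonneg C_nonneg by simp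
  have approx: "\<bar>I\<bar> \<le> A powr (1 - 1 / q) * (M + e) powr (1 / q)" if "0 < e" for e
  proof -
    define m where "m = (M + e) / A"
    define k where "k = m powr (1 - 1 / q)"
    have m: "0 < m" and mA: "m * A = M + e"
      using M that \<open>0 < A\<close> by (auto simp: m_def)
    then have k: "0 < k" by (simp add: k_def)
    have bound: "norm (k * g y) \<le> (w y * C y) * (1 / q) + w y * ((1 - 1 / q) * m)"
      if y: "y \<in> S" for y
    proof -
      have "norm (k * g y) = k * \<bar>g y\<bar>" using k by (simp add: abs_mult)
      also have "\<dots> \<le> w y * (k * C y powr (1 / q))"
        using mult_left_mono[OF g_le[OF y], of k] k by (simp add: mult_ac)
      also have "\<dots> \<le> w y * (C y / q + (1 - 1 / q) * m)"
        unfolding k_def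
        using w_nonneg[OF y] powr_inverse_le_tangent[OF C_nonneg[OF y] m \<open>1 \<le> q\<close>]
        by (rule mult_left_mono[rotated])
      finally show ?thesis by (simp add: algebra_simps)
    qed
    have kg: "((\<lambda>y. k * g y) has_integral k * I) S"
      using has_integral_mult_right[OF g] .
    have B: "((\<lambda>y. (w y * C y) * (1 / q) + w y * ((1 - 1 / q) * m))
              has_integral (M * (1 / q) + A * ((1 - 1 / q) * m))) S"
      by (intro has_integral_add has_integral_mult_left w wC)
    have "k * \<bar>I\<bar> = norm (k * I)" using k by (simp add: abs_mult)
    also have "\<dots> \<le> M * (1 / q) + A * ((1 - 1 / q) * m)"
      unfolding integral_unique[OF kg, symmetric] integral_unique[OF B, symmetric]
      by (rule integral_norm_bound_integral[OF has_integral_integrable[OF kg]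
          has_integral_integrable[OF B] bound])
    also have "\<dots> = M * (1 / q) + (1 - 1 / q) * (M + e)"
      using mA by (simp add: mult_ac)
    also have "\<dots> \<le> (M + e) * (1 / q) + (1 - 1 / q) * (M + e)"
      using that \<open>1 \<le> q\<close> by (intro add_right_mono mult_right_mono) auto
    also have "\<dots> = m * A" using mA by (simp add: algebra_simps)
    also have "\<dots> = k * (A * m powr (1 / q))"
      using m by (simp add: k_def powr_add[symmetric])
    finally have "\<bar>I\<bar> \<le> A * m powr (1 / q)" using k by simp
    also have "\<dots> = A powr (1 - 1 / q) * (M + e) powr (1 / q)"
      using \<open>0 < A\<close> M that by (simp add: m_def powr_divide powr_diff)
    finally show ?thesis .
  qed
  have "((\<lambda>e. (M + e) powr (1 / q)) \<longlongrightarrow> (M + 0) powr (1 / q)) (at_right 0)"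
  proof (rule tendsto_powr')
    have "eventually (\<lambda>e::real. 0 \<le> M + e) (at_right 0)"
      using eventually_at_right_less[of "0 :: real"] by eventually_elim (use M in simp)
    then show "M + 0 \<noteq> 0 \<or> 0 < 1 / q \<and> (\<forall>\<^sub>F e in at_right 0. 0 \<le> M + e)"
      using \<open>1 \<le> q\<close> by simp
  qed (intro tendsto_intros)+
  then have lim: "((\<lambda>e. A powr (1 - 1 / q) * (M + e) powr (1 / q)) \<longlongrightarrow>
                    A powr (1 - 1 / q) * M powr (1 / q)) (at_right 0)"
    using tendsto_mult_left by fastforce
  show ?thesis
  proof (rule tendsto_lowerbound[OF lim])
    show "\<forall>\<^sub>F e in at_right 0. \<bar>I\<bar> \<le> A powr (1 - 1 / q) * (M + e) powr (1 / q)"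
      using eventually_at_right_less[of "0 :: real"] by eventually_elim (rule approx)
  qed simp
qed

text \<open>
  The antiderivatives are written as polynomials in \<open>y - a\<close>, so that they vanish at \<open>a\<close>.
\<close>

lemma has_integral_affine_weight:
  fixes a b p r :: real
  assumes "a \<le> b"
  shows "((\<lambda>y. p * (b - y) + r * (y - a)) has_integral (b - a)^2 * ((p + r) / 2)) {a..b}"
proof -
  define F where "F = (\<lambda>y. p * (b - a) * (y - a) + (r - p) * (y - a)^2 / 2)"
  have "((\<lambda>y. p * (b - y) + r * (y - a)) has_integral F b - F a) {a..b}"
    unfolding F_def
    by (rule fundamental_theorem_of_calculus[OF assms])
       (auto simp: has_real_derivative_iff_has_vector_derivative[symmetric] diff_divide_distrib
               algebra_simps
             intro!: derivative_eq_intros)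
  also have "F b - F a = (b - a)^2 * ((p + r) / 2)"
    by (simp add: F_def field_simps power2_eq_square)
  finally show ?thesis .
qed

lemma has_integral_affine_weight_times_chord:
  fixes a b p r P Q :: real
  assumes "a < b"
  shows "((\<lambda>y. (p * (b - y) + r * (y - a)) * ((P * (b - y) + Q * (y - a)) / (b - a)))
           has_integral (b - a)^2 * (((2 * p + r) * P + (2 * r + p) * Q) / 6)) {a..b}"
proof -
  define L where "L = b - a"
  have L: "L \<noteq> 0" and b: "b = a + L" using assms by (auto simp: L_def)
  define F where "F = (\<lambda>y. L * p * P * (y - a) + (p * (Q - P) + (r - p) * P) * (y - a)^2 / 2
                          + (r - p) * (Q - P) * (y - a)^3 / (3 * L))"
  have "((\<lambda>y. (p * (b - y) + r * (y - a)) * ((P * (b - y) + Q * (y - a)) / (b - a)))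
          has_integral F b - F a) {a..b}"
  proof (rule fundamental_theorem_of_calculus)
    fix y assume "y \<in> {a..b}"
    have "(F has_real_derivative L * p * P + (p * (Q - P) + (r - p) * P) * (y - a)
             + (r - p) * (Q - P) * (y - a)^2 / L) (at y within {a..b})"
      unfolding F_def using L by (auto intro!: derivative_eq_intros simp: field_simps)
    also have "L * p * P + (p * (Q - P) + (r - p) * P) * (y - a) + (r - p) * (Q - P) * (y - a)^2 / L
             = (p * (b - y) + r * (y - a)) * ((P * (b - y) + Q * (y - a)) / (b - a))"
    proof -
      define s where "s = y - a"
      have "b - y = L - s" "b - a = L" "y - a = s" by (auto simp: b s_def)
      then show ?thesis
        using L by (simp only:) (simp add: field_simps power2_eq_square)
    qed
    finally show "(F has_vector_derivative
        (p * (b - y) + r * (y - a)) * ((P * (b - y) + Q * (y - a)) / (b - a))) (at y within {a..b})"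
      by (simp add: has_real_derivative_iff_has_vector_derivative)
  qed (use assms in simp)
  also have "F b - F a = (b - a)^2 * (((2 * p + r) * P + (2 * r + p) * Q) / 6)"
    using L by (simp add: F_def b field_simps power2_eq_square power3_eq_cube)
  finally show ?thesis .
qed

lemma convex_on_le_chord:
  fixes h :: "real \<Rightarrow> real"
  assumes "convex_on {a..b} h" "a < b" "y \<in> {a..b}"
  shows "h y \<le> (h a * (b - y) + h b * (y - a)) / (b - a)"
proof -
  have "h y \<le> (h b - h a) / (b - a) * (y - a) + h a"
    by (rule convex_onD_Icc'[OF assms(1)]) (use assms in auto)
  also have "\<dots> = (h a * (b - y) + h b * (y - a)) / (b - a)"
    using assms(2) by (simp add: field_simps)
  finally show ?thesis .
qed

text \<open>
  The weight is kept in the form \<open>p (b - y) + r (y - a)\<close>, not divided by \<open>b - a\<close>, so that the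
  estimate also holds, as \<open>0 \<le> 0\<close>, on a one-point interval; the point \<open>x\<close> of the theorem may be
  \<open>u\<close> or \<open>v\<close>.
\<close>

lemma abs_affine_weighted_increment_le:
  fixes f f' :: "real \<Rightarrow> real" and a b p r q :: real
  assumes "a \<le> b" and "0 < p" "0 < r" and "1 \<le> q"
    and deriv: "\<And>y. y \<in> {a..b} \<Longrightarrow> (f has_real_derivative f' y) (at y within {a..b})"
    and conv: "convex_on {a..b} (\<lambda>y. \<bar>f' y\<bar> powr q)"
  shows "\<bar>(b - a) * (r * f b - p * f a) - (r - p) * integral {a..b} f\<bar>
       \<le> (b - a)^2 * ((p + r) / 2) powr (1 - 1 / q) * (1 / 6) powr (1 / q)
           * ((2 * p + r) * \<bar>f' a\<bar> powr q + (2 * r + p) * \<bar>f' b\<bar> powr q) powr (1 / q)"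
proof (cases "a = b")
  case True
  then show ?thesis by simp
next
  case False
  with \<open>a \<le> b\<close> have "a < b" by simp
  define w where "w = (\<lambda>y. p * (b - y) + r * (y - a))"
  define P where "P = \<bar>f' a\<bar> powr q"
  define Q where "Q = \<bar>f' b\<bar> powr q"
  define C where "C = (\<lambda>y. (P * (b - y) + Q * (y - a)) / (b - a))"
  define K where "K = (2 * p + r) * P + (2 * r + p) * Q"
  have PQ: "0 \<le> P" "0 \<le> Q" by (auto simp: P_def Q_def)
  have w_nonneg: "0 \<le> w y" if "y \<in> {a..b}" for y
    using that \<open>0 < p\<close> \<open>0 < r\<close> by (auto simp: w_def)
  have C_nonneg: "0 \<le> C y" if "y \<in> {a..b}" for y
    using that PQ by (auto simp: C_def)
  have K: "0 \<le> K" using PQ \<open>0 < p\<close> \<open>0 < r\<close> by (auto simp: K_def)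

  have product_rule: "((\<lambda>y. (r - p) * f y + w y * f' y) has_integral w b * f b - w a * f a) {a..b}"
    using \<open>a \<le> b\<close> deriv
    by (intro fundamental_theorem_of_calculus)
       (auto simp: w_def has_real_derivative_iff_has_vector_derivative[symmetric]
             intro!: derivative_eq_intros)
  have "continuous_on {a..b} f"
    using deriv by (rule DERIV_continuous_on)
  then have "((\<lambda>y. (r - p) * f y) has_integral (r - p) * integral {a..b} f) {a..b}"
    by (intro has_integral_mult_right integrable_integral integrable_continuous_interval)
  from has_integral_diff[OF product_rule this]
  have by_parts: "((\<lambda>y. w y * f' y) has_integral
      (b - a) * (r * f b - p * f a) - (r - p) * integral {a..b} f) {a..b}"
    by (simp add: w_def right_diff_distrib mult_ac)

  have f'_le: "\<bar>w y * f' y\<bar> \<le> w y * C y powr (1 / q)" if y: "y \<in> {a..b}" for y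
  proof -
    have "\<bar>f' y\<bar> = (\<bar>f' y\<bar> powr q) powr (1 / q)"
      using \<open>1 \<le> q\<close> by (simp add: powr_powr)
    also have "\<dots> \<le> C y powr (1 / q)"
      using convex_on_le_chord[OF conv \<open>a < b\<close> y] \<open>1 \<le> q\<close>
      by (intro powr_mono2) (auto simp: C_def P_def Q_def)
    finally show ?thesis
      using w_nonneg[OF y] by (simp add: abs_mult mult_left_mono)
  qed
  have "\<bar>(b - a) * (r * f b - p * f a) - (r - p) * integral {a..b} f\<bar>
      \<le> ((b - a)^2 * ((p + r) / 2)) powr (1 - 1 / q) * ((b - a)^2 * (K / 6)) powr (1 / q)"
  proof (rule abs_integral_le_power_mean[OF by_parts])
    show "(w has_integral (b - a)^2 * ((p + r) / 2)) {a..b}"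
      unfolding w_def using \<open>a \<le> b\<close> by (rule has_integral_affine_weight)
    show "((\<lambda>y. w y * C y) has_integral (b - a)^2 * (K / 6)) {a..b}"
      unfolding w_def C_def K_def using \<open>a < b\<close> by (rule has_integral_affine_weight_times_chord)
  qed (use w_nonneg C_nonneg f'_le \<open>a < b\<close> \<open>0 < p\<close> \<open>0 < r\<close> \<open>1 \<le> q\<close> in auto)
  also have "\<dots> = ((b - a)^2) powr ((1 - 1 / q) + 1 / q) * ((p + r) / 2) powr (1 - 1 / q)
                   * (1 / 6 * K) powr (1 / q)"
    using \<open>0 < p\<close> \<open>0 < r\<close> K by (simp only: powr_mult powr_add) (simp add: powr_mult powr_divide mult_ac)
  also have "\<dots> = (b - a)^2 * ((p + r) / 2) powr (1 - 1 / q) * (1 / 6) powr (1 / q)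
                   * K powr (1 / q)"
    using K by (simp add: powr_mult powr_divide)
  finally show ?thesis by (simp only: K_def P_def Q_def)
qed

theorem theorem8:
  fixes f :: "real \<Rightarrow> real" and u v q x :: real
  assumes "f differentiable_on {0<..}"
    and "0 < u" and "u < v"
    and "deriv f absolutely_integrable_on {u..v}"
    and "q \<ge> 1"
    and "convex_on {u..v} (\<lambda>t. \<bar>deriv f t\<bar> powr q)"
    and "x \<in> {u..v}"
  shows "\<bar>((v - x) * (v * f v - u * f x) + (x - u) * (v * f x - u * f u)) / (v - u)^2
           - 1 / (v - u) * integral {u..v} f\<bar>
       \<le> (v - x)^2 / (v - u)^2 * arith_mean u v powr (1 - 1 / q) * (1 / 6) powr (1 / q)
            * ((2 * u + v) * \<bar>deriv f x\<bar> powr q + (2 * v + u) * \<bar>deriv f v\<bar> powr q) powr (1 / q)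
         + (x - u)^2 / (v - u)^2 * arith_mean u v powr (1 - 1 / q) * (1 / 6) powr (1 / q)
            * ((2 * v + u) * \<bar>deriv f x\<bar> powr q + (2 * u + v) * \<bar>deriv f u\<bar> powr q) powr (1 / q)"
proof -
  have deriv: "(f has_real_derivative deriv f y) (at y within S)" if "0 < y" for y S
  proof -
    have "f differentiable at y"
      using assms(1) that by (auto simp: differentiable_on_def at_within_open[OF _ open_greaterThan])
    then show ?thesis
      by (simp add: differentiable_def DERIV_deriv_iff_real_differentiable has_field_derivative_at_within)
  qed
  have x: "u \<le> x" "x \<le> v" using assms(7) by auto
  define A where "A = (u + v) / 2"
  define T1 where "T1 = (v - x)^2 * A powr (1 - 1 / q) * (1 / 6) powr (1 / q)
    * ((2 * u + v) * \<bar>deriv f x\<bar> powr q + (2 * v + u) * \<bar>deriv f v\<bar> powr q) powr (1 / q)"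
  define T2 where "T2 = (x - u)^2 * A powr (1 - 1 / q) * (1 / 6) powr (1 / q)
    * ((2 * v + u) * \<bar>deriv f x\<bar> powr q + (2 * u + v) * \<bar>deriv f u\<bar> powr q) powr (1 / q)"
  have right: "\<bar>(v - x) * (v * f v - u * f x) - (v - u) * integral {x..v} f\<bar> \<le> T1"
    unfolding T1_def A_def using assms x
    by (intro abs_affine_weighted_increment_le deriv convex_on_subset[OF assms(6)]) auto
  have left: "\<bar>(x - u) * (v * f x - u * f u) - (v - u) * integral {u..x} f\<bar> \<le> T2"
    unfolding T2_def A_def add.commute[of "(2 * v + u) * \<bar>deriv f x\<bar> powr q"] using assms x
    by (intro abs_affine_weighted_increment_le deriv convex_on_subset[OF assms(6)]) auto
  have "f integrable_on {u..v}"
    using assms(2)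
    by (intro integrable_continuous_interval DERIV_continuous_on[OF deriv]) simp
  then have split: "integral {u..v} f = integral {u..x} f + integral {x..v} f"
    using x by (simp add: Henstock_Kurzweil_Integration.integral_combine)
  define N where "N = (v - x) * (v * f v - u * f x) + (x - u) * (v * f x - u * f u)"
  have "N / (v - u)^2 - 1 / (v - u) * integral {u..v} f
      = (N - (v - u) * integral {u..v} f) / (v - u)^2"
    using assms(3) by (simp add: diff_divide_distrib power2_eq_square)
  moreover have "\<bar>N - (v - u) * integral {u..v} f\<bar> \<le> T1 + T2"
    using right left unfolding N_def split by (simp add: distrib_left)
  ultimately have "\<bar>N / (v - u)^2 - 1 / (v - u) * integral {u..v} f\<bar> \<le> (T1 + T2) / (v - u)^2"
    by (simp add: divide_right_mono)
  then show ?thesis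
    unfolding N_def T1_def T2_def A_def arith_mean_def
    by (simp only: add_divide_distrib times_divide_eq_left)
qed

end
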